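(* Let $N,n,m,p$ be positive integers, $A\in\mathbb{R}^{n\times n}$, $B\in\mathbb{R}^{n\times p}$, $C\in\mathbb{R}^{m\times n}$, $H\in\mathbb{R}^{n\times m}$, $W=[w_{ij}]\in\mathbb{R}^{N\times N}$ with $w_{ii}=0$ for all $i$, $\Delta=\mathrm{diag}(\delta_1,\dots,\delta_N)$ with $\delta_i\in\{0,1\}$, and $h>0$. Put $\mathcal{B}(h)=\int_0^h e^{A\tau}d\tau\,B$, $\mathcal{H}(h)=\int_0^h e^{A\tau}d\tau\,HC$, $\Phi_s=I_N\otimes e^{Ah}+W\otimes\mathcal{H}(h)$, $\Psi_s=\Delta\otimes\mathcal{B}(h)$. Let $\sigma(W)=\{\lambda_1,\dots,\lambda_r\}$ be the distinct eigenvalues of $W$ and $E_i=e^{Ah}+\lambda_i\mathcal{H}(h)$, and assume $0\notin\sigma(E_i)$ for every $i=1,\dots,r$. If the networked sampled-data system $X(k+1)=\Phi_sX(k)+\Psi_sU(k)$ is controllable, then the pair $(W,\Delta)$ is controllable and the pair $(E_i,\mathcal{B}(h))$ is controllable for every $i=1,\dots,r$.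
   Context: The networked sampled-data system is the discrete-time system $X(k+1)=\Phi_sX(k)+\Psi_sU(k)$; it is called controllable if every initial state can be steered to the origin in finitely many steps. For $F\in\mathbb{C}^{q\times q}$, $G\in\mathbb{C}^{q\times s}$, the pair $(F,G)$ is called controllable if $\mathrm{rank}[sI_q-F,\ G]=q$ for every $s\in\mathbb{C}$. $\sigma(\cdot)$ denotes the set of eigenvalues and $\otimes$ the Kronecker product. *)

theory Defs
  imports "HOL-Analysis.Analysis"
begin

(* Matrices are rendered as 'a^'cols^'rows (HOL-Analysis); dimensions are finite index types. *)

definition mpow :: "real^'n^'n \<Rightarrow> nat \<Rightarrow> real^'n^'n" where
  "mpow A k = (((**) A) ^^ k) (mat 1)"

(* matrix exponential e^A = sum_k A^k / k! *)
definition mexp :: "real^'n^'n \<Rightarrow> real^'n^'n" where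
  "mexp A = (\<Sum>k. (1 / fact k) *\<^sub>R mpow A k)"

(* int_0^h e^{A tau} d tau *)
definition mexp_int :: "real^'n^'n \<Rightarrow> real \<Rightarrow> real^'n^'n" where
  "mexp_int A h = integral {0..h} (\<lambda>\<tau>. mexp (\<tau> *\<^sub>R A))"

(* Kronecker product *)
definition kron :: "'r::times^'b^'a \<Rightarrow> 'r^'d^'c \<Rightarrow> 'r^('b \<times> 'd)^('a \<times> 'c)" where
  "kron X Y = (\<chi> ik jl. X $ fst ik $ fst jl * Y $ snd ik $ snd jl)"

definition cmat :: "real^'b^'a \<Rightarrow> complex^'b^'a" where
  "cmat X = (\<chi> i j. complex_of_real (X $ i $ j))"

(* scalar multiple of a matrix *)
definition smat :: "'r::times \<Rightarrow> 'r^'b^'a \<Rightarrow> 'r^'b^'a" where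
  "smat c X = (\<chi> i j. c * X $ i $ j)"

(* horizontal block concatenation [F, G] *)
definition hcat :: "'r^'b^'a \<Rightarrow> 'r^'c^'a \<Rightarrow> 'r^('b + 'c)^'a" where
  "hcat F G = (\<chi> i j. case j of Inl j' \<Rightarrow> F $ i $ j' | Inr j' \<Rightarrow> G $ i $ j')"

(* (F,G) controllable: rank [sI - F, G] = q for all complex s *)
definition ctrb_pair :: "complex^'q^'q \<Rightarrow> complex^'s^'q \<Rightarrow> bool" where
  "ctrb_pair F G \<longleftrightarrow> (\<forall>s::complex. rank (hcat (mat s - F) G) = CARD('q))"

(* set of eigenvalues of a complex square matrix *)
definition spectrum :: "complex^'n^'n \<Rightarrow> complex set" where
  "spectrum M = {c. \<exists>v. v \<noteq> 0 \<and> M *v v = c *s v}"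

(* trajectory of X(k+1) = Phi X(k) + Psi U(k) *)
primrec dtraj :: "real^'x^'x \<Rightarrow> real^'u^'x \<Rightarrow> real^'x \<Rightarrow> (nat \<Rightarrow> real^'u) \<Rightarrow> nat \<Rightarrow> real^'x" where
  "dtraj Phi Psi X0 U 0 = X0"
| "dtraj Phi Psi X0 U (Suc k) = Phi *v dtraj Phi Psi X0 U k + Psi *v U k"

(* controllable: every initial state can be steered to the origin in finitely many steps *)
definition dctrb :: "real^'x^'x \<Rightarrow> real^'u^'x \<Rightarrow> bool" where
  "dctrb Phi Psi \<longleftrightarrow> (\<forall>X0. \<exists>k U. dtraj Phi Psi X0 U k = 0)"

end

theory Submission
  imports Defs
begin

(* A PBH-type argument. If either rank condition fails, there are a left eigenvector y of W,
   y W = \<lambda> y, and row vectors \<eta>_k with \<eta>_(k+1) E_\<lambda> = \<eta>_k, such that y \<Delta> = 0 or all \<eta>_k B(h) = 0: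
   in the first case \<eta> is a backward orbit of E_\<lambda>, which exists because E_\<lambda> is invertible; in the
   second \<eta>_k = t^-k \<eta>_0 for a left eigenvector \<eta>_0 of E_\<lambda> with eigenvalue t \<noteq> 0. Then
   w_k = y \<otimes> \<eta>_k satisfies w_(k+1) \<Phi>_s = w_k and w_k \<Psi>_s = 0, so the pairing of w_k with the
   state X(k) is conserved along every trajectory, and no initial state X(0) with
   w_0 X(0) \<noteq> 0 can be steered to the origin. *)

lemma matrix_vector_mult_mat: "(mat s :: 'a::comm_ring_1^'n^'n) *v x = s *s x"
  by (simp add: vec_eq_iff matrix_vector_mult_def mat_def if_distrib if_distribR
      cong del: if_weak_cong)

lemma vector_matrix_mult_mat: "(x :: 'a::comm_ring_1^'n) v* mat s = s *s x"
  by (metis matrix_vector_mult_mat transpose_mat transpose_matrix_vector)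

lemma vector_matrix_mult_smat: "(y :: 'a::comm_ring_1^'n) v* smat c (Q :: 'a^'m^'n) = c *s (y v* Q)"
  by (simp add: vec_eq_iff vector_matrix_mult_def smat_def sum_distrib_left algebra_simps)

lemma rank_eq_card_rows_if_left_kernel_trivial:
  fixes M :: "'a::field^'n^'m"
  assumes "\<forall>y. y v* M = 0 \<longrightarrow> y = 0"
  shows "rank M = CARD('m)"
proof -
  let ?f = "(*v) (transpose M)"
  have pair: "finite_dimensional_vector_space_pair_1
      ((*s) :: 'a \<Rightarrow> 'a^'m \<Rightarrow> 'a^'m) cart_basis ((*s) :: 'a \<Rightarrow> 'a^'n \<Rightarrow> 'a^'n)"
    by unfold_locales
  have "inj ?f"
    using assms by (simp add: vec.inj_iff_eq_0)
  have "?f (axis i 1) = row i M" for i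
    by (simp add: vec_eq_iff row_def vector_matrix_mult_def axis_def if_distrib if_distribR
        cong del: if_weak_cong)
  then have "?f ` cart_basis = rows M"
    unfolding cart_basis_def rows_def Setcompr_eq_image image_image by simp
  moreover have "vec.dim (?f ` cart_basis) = vec.dim (cart_basis :: ('a^'m) set)"
    using \<open>inj ?f\<close>
    by (intro finite_dimensional_vector_space_pair_1.dim_image_eq[OF pair matrix_vector_mul_linear_gen])
      (auto simp: inj_on_def)
  ultimately show ?thesis
    by (metis row_rank_def_gen vec.dim_eq_card_independent independent_cart_basis card_cart_basis)
qed

lemma left_kernel_trivial_iff_kernel_trivial:
  fixes M :: "'a::field^'n^'n"
  shows "(\<forall>y. y v* M = 0 \<longrightarrow> y = 0) \<longleftrightarrow> (\<forall>x. M *v x = 0 \<longrightarrow> x = 0)"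
  by (metis matrix_left_invertible_ker left_invertible_transpose matrix_left_right_inverse
      transpose_matrix_vector)

lemma spectrum_iff_left_eigenvector:
  "s \<in> spectrum M \<longleftrightarrow> (\<exists>y. y \<noteq> 0 \<and> y v* M = s *s y)"
proof -
  have "s \<in> spectrum M \<longleftrightarrow> (\<exists>x. x \<noteq> 0 \<and> (mat s - M) *v x = 0)"
    by (auto simp: spectrum_def matrix_vector_mult_diff_rdistrib matrix_vector_mult_mat)
  also have "\<dots> \<longleftrightarrow> (\<exists>y. y \<noteq> 0 \<and> y v* (mat s - M) = 0)"
    using left_kernel_trivial_iff_kernel_trivial[of "mat s - M"] by blast
  also have "\<dots> \<longleftrightarrow> (\<exists>y. y \<noteq> 0 \<and> y v* M = s *s y)"
    by (auto simp: vector_matrix_mult_diff_rdistrib vector_matrix_mult_mat)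
  finally show ?thesis .
qed

lemma zero_notin_spectrum_iff: "0 \<notin> spectrum M \<longleftrightarrow> (\<forall>x. M *v x = 0 \<longrightarrow> x = 0)"
  by (auto simp: spectrum_def)

lemma vector_matrix_mult_hcat_eq_0_iff:
  fixes F :: "'a::comm_ring_1^'b^'q" and G :: "'a^'c^'q"
  shows "y v* hcat F G = 0 \<longleftrightarrow> y v* F = 0 \<and> y v* G = 0"
proof -
  have "(y v* hcat F G) $ Inl j = (y v* F) $ j" "(y v* hcat F G) $ Inr k = (y v* G) $ k" for j k
    by (simp_all add: hcat_def vector_matrix_mult_def)
  then show ?thesis
    by (simp add: vec_eq_iff split_sum_all)
qed

lemma not_ctrb_pair_imp_left_eigenvector:
  fixes F :: "complex^'q^'q" and G :: "complex^'c^'q"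
  assumes "\<not> ctrb_pair F G"
  obtains s y where "y \<noteq> 0" "y v* F = s *s y" "y v* G = 0"
proof -
  obtain s where "rank (hcat (mat s - F) G) \<noteq> CARD('q)"
    using assms by (auto simp: ctrb_pair_def)
  then obtain y where "y \<noteq> 0" "y v* hcat (mat s - F) G = 0"
    using rank_eq_card_rows_if_left_kernel_trivial by blast
  then have "y v* (mat s - F) = 0" and yG: "y v* G = 0"
    by (simp_all add: vector_matrix_mult_hcat_eq_0_iff)
  then have "y v* F = s *s y"
    by (simp add: vector_matrix_mult_diff_rdistrib vector_matrix_mult_mat)
  with \<open>y \<noteq> 0\<close> yG show thesis
    using that by blast
qed

definition vkron :: "'a::times^'i \<Rightarrow> 'a^'j \<Rightarrow> 'a^('i \<times> 'j)" where
  "vkron x y = (\<chi> ij. x $ fst ij * y $ snd ij)"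

lemma vkron_vector_matrix_mult_kron:
  fixes x :: "'a::comm_semiring_1^'i" and y :: "'a^'j" and X :: "'a^'k^'i" and Y :: "'a^'l^'j"
  shows "vkron x y v* kron X Y = vkron (x v* X) (y v* Y)"
proof -
  have "(\<Sum>p\<in>UNIV. vkron x y $ p * kron X Y $ p $ q) =
        (\<Sum>i\<in>UNIV. x $ i * X $ i $ fst q) * (\<Sum>j\<in>UNIV. y $ j * Y $ j $ snd q)" for q
  proof -
    have "(\<Sum>p\<in>UNIV. vkron x y $ p * kron X Y $ p $ q) =
          (\<Sum>p\<in>UNIV \<times> UNIV. (x $ fst p * X $ fst p $ fst q) * (y $ snd p * Y $ snd p $ snd q))"
      by (simp add: UNIV_Times_UNIV vkron_def kron_def mult_ac)
    also have "\<dots> = (\<Sum>i\<in>UNIV. x $ i * X $ i $ fst q) * (\<Sum>j\<in>UNIV. y $ j * Y $ j $ snd q)"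
      by (simp add: sum_product sum.cartesian_product case_prod_unfold)
    finally show ?thesis .
  qed
  then show ?thesis
    by (simp add: vec_eq_iff vector_matrix_mult_def vkron_def)
qed

lemma vkron_nonzero:
  fixes x :: "'a::semiring_no_zero_divisors^'i" and y :: "'a^'j"
  assumes "x \<noteq> 0" "y \<noteq> 0"
  shows "vkron x y \<noteq> 0"
proof -
  obtain i j where "x $ i \<noteq> 0" "y $ j \<noteq> 0"
    using assms by (metis vec_eq_iff zero_index)
  then have "vkron x y $ (i, j) \<noteq> 0"
    by (simp add: vkron_def)
  then show ?thesis
    by auto
qed

lemma vkron_0_left [simp]: "vkron 0 y = (0 :: 'a::mult_zero^('i::finite \<times> 'j::finite))"
  and vkron_0_right [simp]: "vkron x 0 = (0 :: 'a::mult_zero^('i::finite \<times> 'j::finite))"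
  by (simp_all add: vec_eq_iff vkron_def)

lemma vkron_add_right: "vkron x y + vkron x z = vkron x (y + z :: 'a::semiring^'j)"
  by (simp add: vec_eq_iff vkron_def distrib_left)

lemma vkron_scale: "vkron (c *s x) y = vkron x (c *s y :: 'a::ab_semigroup_mult^'j)"
  by (simp add: vec_eq_iff vkron_def mult_ac)

lemma cmat_add: "cmat (P + Q) = cmat P + cmat Q"
  by (simp add: vec_eq_iff cmat_def)

lemma cmat_mat: "cmat (mat c) = mat (complex_of_real c)"
  by (simp add: vec_eq_iff cmat_def mat_def)

lemma cmat_kron: "cmat (kron X Y) = kron (cmat X) (cmat Y)"
  by (simp add: vec_eq_iff cmat_def kron_def)

definition cpair :: "complex^'a \<Rightarrow> real^'a \<Rightarrow> complex" where
  "cpair w x = (\<Sum>i\<in>UNIV. w $ i * complex_of_real (x $ i))"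

lemma cpair_add_right: "cpair w (x + x') = cpair w x + cpair w x'"
  by (simp add: cpair_def sum.distrib distrib_left)

lemma cpair_matrix_vector_mult: "cpair w (M *v x) = cpair (w v* cmat M) x"
proof -
  have "cpair w (M *v x) =
        (\<Sum>i\<in>UNIV. \<Sum>j\<in>UNIV. w $ i * complex_of_real (M $ i $ j) * complex_of_real (x $ j))"
    by (simp add: cpair_def matrix_vector_mult_def sum_distrib_left mult.assoc)
  also have "\<dots> = (\<Sum>j\<in>UNIV. (\<Sum>i\<in>UNIV. w $ i * complex_of_real (M $ i $ j)) * complex_of_real (x $ j))"
    by (subst sum.swap) (simp add: sum_distrib_right)
  also have "\<dots> = cpair (w v* cmat M) x"
    by (simp add: cpair_def vector_matrix_mult_def cmat_def)
  finally show ?thesis .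
qed

lemma not_dctrb_if_dual_sequence:
  fixes Phi :: "real^'x^'x" and Psi :: "real^'u^'x" and w :: "nat \<Rightarrow> complex^'x"
  assumes "w 0 \<noteq> 0"
    and step: "\<And>k. w (Suc k) v* cmat Phi = w k"
    and annihilates: "\<And>k. w k v* cmat Psi = 0"
  shows "\<not> dctrb Phi Psi"
proof
  assume "dctrb Phi Psi"
  obtain i where "w 0 $ i \<noteq> 0"
    using \<open>w 0 \<noteq> 0\<close> by (metis vec_eq_iff zero_index)
  obtain k U where "dtraj Phi Psi (axis i 1) U k = 0"
    using \<open>dctrb Phi Psi\<close> unfolding dctrb_def by blast
  have conserved: "cpair (w j) (dtraj Phi Psi (axis i 1) U j) = cpair (w 0) (axis i 1)" for j
  proof (induction j)
    case (Suc j)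
    then show ?case
      by (simp add: cpair_add_right cpair_matrix_vector_mult step annihilates)
        (simp add: cpair_def)
  qed simp
  have "cpair (w 0) (axis i 1) = w 0 $ i"
    by (simp add: cpair_def axis_def if_distrib if_distribR cong del: if_weak_cong)
  with conserved[of k] \<open>dtraj Phi Psi (axis i 1) U k = 0\<close> \<open>w 0 $ i \<noteq> 0\<close> show False
    by (simp add: cpair_def)
qed

lemma backward_orbit_exists:
  fixes M :: "'a::field^'n^'n"
  assumes "\<forall>x. M *v x = 0 \<longrightarrow> x = 0"
  shows "\<exists>\<eta>. \<eta> 0 = v \<and> (\<forall>k. \<eta> (Suc k) v* M = \<eta> k)"
proof -
  have "\<exists>L. L ** M = mat 1"
    using assms by (subst matrix_left_invertible_ker)
  then obtain L where "L ** M = mat 1" ..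
  then have "(z v* L) v* M = z" for z
    by (simp add: vector_matrix_mul_assoc)
  then show ?thesis
    by (intro exI[of _ "\<lambda>k. ((\<lambda>z. z v* L) ^^ k) v"]) simp
qed

lemma kron_network_not_dctrb:
  fixes E0 Hm :: "real^'n^'n" and W D :: "real^'N^'N" and Bm :: "real^'p^'n"
  assumes "y \<noteq> 0" and y_left_eigen: "y v* cmat W = s *s y"
    and "\<eta> 0 \<noteq> 0" and \<eta>_step: "\<And>k. \<eta> (Suc k) v* (cmat E0 + smat s (cmat Hm)) = \<eta> k"
    and annihilates: "y v* cmat D = 0 \<or> (\<forall>k. \<eta> k v* cmat Bm = 0)"
  shows "\<not> dctrb (kron (mat 1 :: real^'N^'N) E0 + kron W Hm) (kron D Bm)"
proof (rule not_dctrb_if_dual_sequence[where w = "\<lambda>k. vkron y (\<eta> k)"])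
  show "vkron y (\<eta> 0) \<noteq> 0"
    using \<open>y \<noteq> 0\<close> \<open>\<eta> 0 \<noteq> 0\<close> by (rule vkron_nonzero)
  show "vkron y (\<eta> (Suc k)) v* cmat (kron (mat 1 :: real^'N^'N) E0 + kron W Hm) = vkron y (\<eta> k)" for k
  proof -
    have "vkron y (\<eta> (Suc k)) v* cmat (kron (mat 1 :: real^'N^'N) E0 + kron W Hm)
        = vkron y (\<eta> (Suc k) v* cmat E0) + vkron (s *s y) (\<eta> (Suc k) v* cmat Hm)"
      by (simp add: cmat_add cmat_kron cmat_mat vector_matrix_mult_add_rdistrib
          vkron_vector_matrix_mult_kron y_left_eigen)
    also have "\<dots> = vkron y (\<eta> (Suc k) v* (cmat E0 + smat s (cmat Hm)))"
      by (simp add: vkron_scale vkron_add_right vector_matrix_mult_add_rdistrib vector_matrix_mult_smat)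
    finally show ?thesis
      by (simp add: \<eta>_step)
  qed
  show "vkron y (\<eta> k) v* cmat (kron D Bm) = 0" for k
    using annihilates by (auto simp: cmat_kron vkron_vector_matrix_mult_kron)
qed

lemma network_dctrb_imp_ctrb_pair_coupling:
  fixes E0 Hm :: "real^'n^'n" and W D :: "real^'N^'N" and Bm :: "real^'p^'n"
  assumes node_inv: "\<forall>\<mu>\<in>spectrum (cmat W). 0 \<notin> spectrum (cmat E0 + smat \<mu> (cmat Hm))"
    and network_dctrb: "dctrb (kron (mat 1 :: real^'N^'N) E0 + kron W Hm) (kron D Bm)"
  shows "ctrb_pair (cmat W) (cmat D)"
proof (rule ccontr)
  assume "\<not> ctrb_pair (cmat W) (cmat D)"
  then obtain s y where "y \<noteq> 0" "y v* cmat W = s *s y" "y v* cmat D = 0"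
    by (rule not_ctrb_pair_imp_left_eigenvector)
  then have "s \<in> spectrum (cmat W)"
    by (auto simp: spectrum_iff_left_eigenvector)
  with node_inv have "\<forall>x. (cmat E0 + smat s (cmat Hm)) *v x = 0 \<longrightarrow> x = 0"
    by (simp add: zero_notin_spectrum_iff)
  then obtain \<eta> where "\<eta> 0 = 1" and \<eta>_step: "\<forall>k. \<eta> (Suc k) v* (cmat E0 + smat s (cmat Hm)) = \<eta> k"
    using backward_orbit_exists by blast
  then have "\<eta> 0 \<noteq> 0"
    by (simp add: vec_eq_iff)
  then have "\<not> dctrb (kron (mat 1 :: real^'N^'N) E0 + kron W Hm) (kron D Bm)"
    using kron_network_not_dctrb \<open>y \<noteq> 0\<close> \<open>y v* cmat W = s *s y\<close> \<eta>_step \<open>y v* cmat D = 0\<close>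
    by blast
  then show False
    using network_dctrb ..
qed

lemma network_dctrb_imp_ctrb_pair_node:
  fixes E0 Hm :: "real^'n^'n" and W D :: "real^'N^'N" and Bm :: "real^'p^'n"
  assumes node_inv: "\<forall>\<mu>\<in>spectrum (cmat W). 0 \<notin> spectrum (cmat E0 + smat \<mu> (cmat Hm))"
    and network_dctrb: "dctrb (kron (mat 1 :: real^'N^'N) E0 + kron W Hm) (kron D Bm)"
    and "\<mu> \<in> spectrum (cmat W)"
  shows "ctrb_pair (cmat E0 + smat \<mu> (cmat Hm)) (cmat Bm)"
proof (rule ccontr)
  let ?E = "cmat E0 + smat \<mu> (cmat Hm)"
  assume "\<not> ctrb_pair ?E (cmat Bm)"
  then obtain t e where "e \<noteq> 0" and e_left_eigen: "e v* ?E = t *s e" and "e v* cmat Bm = 0"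
    by (rule not_ctrb_pair_imp_left_eigenvector)
  have "t \<noteq> 0"
  proof
    assume "t = 0"
    with \<open>e \<noteq> 0\<close> e_left_eigen have "0 \<in> spectrum ?E"
      unfolding spectrum_iff_left_eigenvector by blast
    with node_inv \<open>\<mu> \<in> spectrum (cmat W)\<close> show False
      by blast
  qed
  obtain y where "y \<noteq> 0" "y v* cmat W = \<mu> *s y"
    using \<open>\<mu> \<in> spectrum (cmat W)\<close> spectrum_iff_left_eigenvector by blast
  define \<eta> where "\<eta> k = (inverse t ^ k) *s e" for k
  have "\<eta> 0 \<noteq> 0"
    using \<open>e \<noteq> 0\<close> by (simp add: \<eta>_def)
  moreover have "\<eta> (Suc k) v* ?E = \<eta> k" for k
    using \<open>t \<noteq> 0\<close> by (simp add: \<eta>_def scalar_vector_matrix_assoc e_left_eigen)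
  moreover have "\<forall>k. \<eta> k v* cmat Bm = 0"
    by (simp add: \<eta>_def scalar_vector_matrix_assoc \<open>e v* cmat Bm = 0\<close>)
  ultimately have "\<not> dctrb (kron (mat 1 :: real^'N^'N) E0 + kron W Hm) (kron D Bm)"
    using kron_network_not_dctrb \<open>y \<noteq> 0\<close> \<open>y v* cmat W = \<mu> *s y\<close> by blast
  then show False
    using network_dctrb ..
qed

theorem corollary2:
  fixes A :: "real^'n^'n" and B :: "real^'p^'n" and C :: "real^'n^'m"
    and H :: "real^'m^'n" and W :: "real^'N^'N" and \<delta> :: "'N \<Rightarrow> real" and h :: real
  assumes W_diag: "\<forall>i. W $ i $ i = 0"
    and \<delta>01: "\<forall>i. \<delta> i \<in> {0, 1}"
    and h_pos: "h > 0"
    and E_inv: "\<forall>\<mu>\<in>spectrum (cmat W).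
                  0 \<notin> spectrum (cmat (mexp (h *\<^sub>R A)) + smat \<mu> (cmat (mexp_int A h ** H ** C)))"
    and ctrb: "dctrb (kron (mat 1 :: real^'N^'N) (mexp (h *\<^sub>R A)) + kron W (mexp_int A h ** H ** C))
                     (kron (\<chi> i j. if i = j then \<delta> i else 0) (mexp_int A h ** B))"
  shows "ctrb_pair (cmat W) (cmat (\<chi> i j. if i = j then \<delta> i else 0 :: real^'N^'N))
       \<and> (\<forall>\<mu>\<in>spectrum (cmat W).
            ctrb_pair (cmat (mexp (h *\<^sub>R A)) + smat \<mu> (cmat (mexp_int A h ** H ** C)))
                      (cmat (mexp_int A h ** B)))"
  using network_dctrb_imp_ctrb_pair_coupling[OF E_inv ctrb]
    network_dctrb_imp_ctrb_pair_node[OF E_inv ctrb]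
  by blast

end
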